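(* Let $X=X_n(\mathbf d)$ be a non-exceptional Fano complete intersection of dimension $n\ge 3$ with $\gcd(n-2,\mathsf a(n,\mathbf d))>1$. Then $F$ can be reconstructed, by the equations (A), (E) and the dimension constraint (Dim) of the context, from $F^{(0)}$.
   Context: $X=X_n(\mathbf d)\subset\mathbb P^{n+r}$ is a smooth complex complete intersection of dimension $n\ge3$ and multidegree $\mathbf d=(d_1,\dots,d_r)$, all $d_i\ge2$; non-exceptional means (for $n\ge 3$) neither $\mathbf d=(2)$ nor ($\mathbf d=(2,2)$ and $n$ even). $\mathsf a=\mathsf a(n,\mathbf d)=n+r+1-\sum_i d_i$ is the Fano index; Fano means $\mathsf a>0$. $\mathsf h$ is the hyperplane class, $\mathsf h_i$ its $i$-th cup power; $\mathsf h_0,\dots,\mathsf h_n$ is a basis of the ambient cohomology $H^*_{\mathrm{amb}}(X)$ (the image of $H^*(\mathbb P^{n+r})$) with dual coordinates $t^0,\dots,t^n$; $g_{ef}=\int_X\mathsf h_e\cup\mathsf h_f$ with inverse matrix $(g^{ef})$. $\gamma_{n+1},\dots,\gamma_{n+m}$ is a basis of the primitive cohomology $H^n_{\mathrm{prim}}(X)$, $m=\mathrm{rank}\,H^n_{\mathrm{prim}}(X)$, with dual coordinates $t^{n+1},\dots,t^{n+m}$ (anticommuting if $n$ is odd), and $s=\frac{(-1)^n}{2}\sum_{i,j=n+1}^{n+m}(\int_X\gamma_i\cup\gamma_j)t^it^j$. With $\gamma_i=\mathsf h_i$ for $0\le i\le n$, $F=\sum_{k\ge0}\sum_{\beta}\frac1{k!}\langle\sum_i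 t^i\gamma_i,\dots,\sum_i t^i\gamma_i\rangle_{0,k,\beta}$ is the generating function of genus $0$ primary Gromov–Witten invariants of $X$ (Novikov variable set to $1$). By monodromy invariance $F$ is a formal power series in $t^0,\dots,t^n,s$ (of degree $\le m/2$ in $s$ if $n$ is odd). $F^{(0)}=F|_{s=0}$ is the generating function of the invariants with only ambient insertions. Subscripts on $F$ denote partial derivatives and repeated indices $e,f$ are summed over $0,\dots,n$. $F$ satisfies: (A) $F_{abe}g^{ef}F_{sf}+2sF_{sab}F_{ss}=F_{sa}F_{sb}$ for $0\le a,b\le n$ (modulo $s^{m/2}$ if $n$ is odd); (E) $EF=(3-n)F+\mathsf a\,\frac{\partial c}{\partial t^1}$, where $E=\sum_{i=0}^n(1-i)t^i\frac{\partial}{\partial t^i}+(2-n)s\frac{\partial}{\partial s}+\mathsf a\frac{\partial}{\partial t^1}$ is the Euler vector field and $c=\frac16\sum_{i,j,k} t^it^jt^k\int_X\gamma_i\gamma_j\gamma_k$ is the classical triple intersection form; (Dim) $\langle\gamma_{i_1},\dots,\gamma_{i_k}\rangle_{0,k,\beta}=0$ unless $\sum_{j=1}^k\deg\gamma_{i_j}=n-3+k+\mathsf a\beta$, where $\deg$ is the complex degree ($\deg\mathsf h_i=i$, and $\deg\gamma=\frac n2$ for primitive $\gamma$) and $\beta$ is identified with its degree, a non-negative integer. *)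

theory Defs
  imports
    Complex_Main
    "HOL-Library.Multiset"
    "HOL-Combinatorics.Multiset_Permutations"
    "HOL-Computational_Algebra.Formal_Power_Series"
begin

section \<open>Numerical data and cohomology of the complete intersection\<close>

text \<open>
  A smooth complete intersection of dimension \<open>n\<close> and multidegree \<open>d = [d\<^sub>1, \<dots>, d\<^sub>r]\<close>.
  The index \<open>i \<le> n\<close> stands for the ambient class \<open>h\<^sub>i\<close> (the \<open>i\<close>-th power of the hyperplane class),
  an index \<open>i\<close> with \<open>n < i \<le> n + m\<close> for the element \<open>\<gamma>\<^sub>i\<close> of a basis of the primitive cohomology.
  \<open>Q i j\<close> (for \<open>n < i, j \<le> n + m\<close>) is the integral of \<open>\<gamma>\<^sub>i \<union> \<gamma>\<^sub>j\<close>.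
\<close>

definition fano_index :: "nat \<Rightarrow> nat list \<Rightarrow> int" where
  "fano_index n d = int n + int (length d) + 1 - int (sum_list d)"

definition exceptional :: "nat \<Rightarrow> nat list \<Rightarrow> bool" where
  "exceptional n d \<longleftrightarrow> d = [2] \<or> (d = [2, 2] \<and> even n)"

definition primitive_pairing :: "nat \<Rightarrow> nat \<Rightarrow> (nat \<Rightarrow> nat \<Rightarrow> complex) \<Rightarrow> bool" where
  "primitive_pairing n m Q \<longleftrightarrow>
     (\<forall>i\<in>{n+1..n+m}. \<forall>j\<in>{n+1..n+m}. Q i j = (-1) ^ n * Q j i) \<and>
     (\<forall>v. (\<forall>j\<in>{n+1..n+m}. (\<Sum>i=n+1..n+m. v i * Q i j) = 0) \<longrightarrow> (\<forall>i\<in>{n+1..n+m}. v i = 0))"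

text \<open>
  The integral over \<open>X\<close> of the cup product of the basis classes with the given indices.  It uses
  that the integral of \<open>h\<^sub>n\<close> is \<open>d\<^sub>1 \<cdots> d\<^sub>r\<close>, that \<open>h\<^sub>i \<union> \<gamma> = 0\<close> for \<open>i > 0\<close> and \<open>\<gamma>\<close> primitive, and
  that a product of three or more primitive classes vanishes for degree reasons.  Ambient classes
  have even degree, so only the order of the primitive indices matters.
\<close>

definition intersection_number ::
  "nat \<Rightarrow> nat list \<Rightarrow> (nat \<Rightarrow> nat \<Rightarrow> complex) \<Rightarrow> nat list \<Rightarrow> complex" where
  "intersection_number n d Q is =
     (let a = sum_list (filter (\<lambda>i. i \<le> n) is) in
      case filter (\<lambda>i. n < i) is of
        [] \<Rightarrow> (if a = n then of_nat (prod_list d) else 0)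
      | [p, q] \<Rightarrow> (if a = 0 then Q p q else 0)
      | _ \<Rightarrow> 0)"

definition ambient_metric :: "nat \<Rightarrow> nat list \<Rightarrow> nat \<Rightarrow> nat \<Rightarrow> complex" where
  "ambient_metric n d e f = intersection_number n d (\<lambda>_ _. 0) [e, f]"

definition ambient_metric_inv :: "nat \<Rightarrow> nat list \<Rightarrow> nat \<Rightarrow> nat \<Rightarrow> complex" where
  "ambient_metric_inv n d e f = (if e + f = n then 1 / of_nat (prod_list d) else 0)"

lemma ambient_metric_eq:
  assumes "e \<le> n" "f \<le> n"
  shows "ambient_metric n d e f = (if e + f = n then of_nat (prod_list d) else 0)"
  using assms by (simp add: ambient_metric_def intersection_number_def)

lemma ambient_metric_inverse:
  assumes "\<forall>i\<in>set d. 2 \<le> i" "e \<le> n" "k \<le> n"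
  shows "(\<Sum>f\<le>n. ambient_metric n d e f * ambient_metric_inv n d f k) = (if e = k then 1 else 0)"
proof -
  have nz: "prod_list d \<noteq> 0"
    using assms(1) by (auto simp: prod_list_zero_iff)
  have "(\<Sum>f\<le>n. ambient_metric n d e f * ambient_metric_inv n d f k)
      = (\<Sum>f\<le>n. if f = n - e then (if e = k then 1 else 0) else 0)"
    using assms(2,3) nz
    by (intro sum.cong) (auto simp: ambient_metric_eq ambient_metric_inv_def)
  then show ?thesis by simp
qed


section \<open>Gromov--Witten invariants\<close>

definition class_degree :: "nat \<Rightarrow> nat \<Rightarrow> real" where
  "class_degree n i = (if i \<le> n then real i else real n / 2)"

text \<open>
  \<open>gw \<beta> [i\<^sub>1, \<dots>, i\<^sub>k]\<close> is the genus zero primary invariant with insertions \<open>\<gamma>\<^sub>i\<^sub>1, \<dots>, \<gamma>\<^sub>i\<^sub>k\<close> in degree \<open>\<beta>\<close>.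
  The moduli of stable maps is not available here; the invariants enter through the dimension
  constraint, graded symmetry, and the fact that those of degree \<open>\<beta> = 0\<close> are the classical triple
  intersection numbers (the unstable ones, with \<open>\<beta> = 0\<close> and \<open>k < 3\<close>, are zero by convention).
\<close>

definition dimension_constraint ::
  "nat \<Rightarrow> nat list \<Rightarrow> nat \<Rightarrow> (nat \<Rightarrow> nat list \<Rightarrow> complex) \<Rightarrow> bool" where
  "dimension_constraint n d m gw \<longleftrightarrow>
     (\<forall>\<beta> is. set is \<subseteq> {..n+m} \<longrightarrow>
        (\<Sum>i\<leftarrow>is. class_degree n i)
          \<noteq> real n - 3 + real (length is) + of_int (fano_index n d) * real \<beta> \<longrightarrow>
        gw \<beta> is = 0)"

definition graded_symmetric :: "nat \<Rightarrow> nat \<Rightarrow> (nat \<Rightarrow> nat list \<Rightarrow> complex) \<Rightarrow> bool" where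
  "graded_symmetric n m gw \<longleftrightarrow>
     (\<forall>\<beta> is i j js. set (is @ i # j # js) \<subseteq> {..n+m} \<longrightarrow>
        gw \<beta> (is @ i # j # js)
          = (if odd n \<and> n < i \<and> n < j then -1 else 1) * gw \<beta> (is @ j # i # js))"

definition classical_limit ::
  "nat \<Rightarrow> nat list \<Rightarrow> nat \<Rightarrow> (nat \<Rightarrow> nat \<Rightarrow> complex) \<Rightarrow> (nat \<Rightarrow> nat list \<Rightarrow> complex) \<Rightarrow> bool" where
  "classical_limit n d m Q gw \<longleftrightarrow>
     (\<forall>is. set is \<subseteq> {..n+m} \<longrightarrow>
        gw 0 is = (if length is = 3 then intersection_number n d Q is else 0))"


section \<open>Power series in the coordinates of the full cohomology\<close>

text \<open>
  A function \<open>w\<close> on words represents the formal sum of all \<open>w [i\<^sub>1, \<dots>, i\<^sub>k] t\<^sup>i\<^sup>1 \<cdots> t\<^sup>i\<^sup>k\<close>, where the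
  primitive coordinates \<open>t\<^sup>i\<close>, \<open>n < i\<close>, anticommute if \<open>n\<close> is odd and all other pairs commute.
  \<open>super_coeff n w \<mu>\<close> is its coefficient at the monomial \<open>\<mu>\<close> with factors in increasing order;
  \<open>super_sign\<close> is the sign of the reordering (zero if an anticommuting variable is repeated).
\<close>

definition super_sign :: "nat \<Rightarrow> nat list \<Rightarrow> complex" where
  "super_sign n is =
     (let js = filter (\<lambda>i. n < i) is in
      if even n then 1
      else if distinct js
        then (-1) ^ card {(a, b). a < b \<and> b < length js \<and> js ! b < js ! a}
        else 0)"

definition super_coeff :: "nat \<Rightarrow> (nat list \<Rightarrow> complex) \<Rightarrow> nat multiset \<Rightarrow> complex" where
  "super_coeff n w \<mu> = (\<Sum>is\<in>permutations_of_multiset \<mu>. super_sign n is * w is)"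

text \<open>
  The word function of the sum over \<open>k\<close> and \<open>\<beta>\<close> of \<open>1/k! \<langle>\<Sum>t\<^sup>i\<gamma>\<^sub>i, \<dots>, \<Sum>t\<^sup>i\<gamma>\<^sub>i\<rangle>\<close>, with Novikov variable 1.
  Moving the \<open>p\<close> odd coordinates to the left past the odd classes costs \<open>0 + 1 + \<dots> + (p - 1)\<close>
  signs.  By the dimension constraint at most one \<open>\<beta>\<close> contributes if the Fano index is positive.
\<close>

definition gw_word :: "nat \<Rightarrow> (nat \<Rightarrow> nat list \<Rightarrow> complex) \<Rightarrow> nat list \<Rightarrow> complex" where
  "gw_word n gw is =
     (let p = length (filter (\<lambda>i. n < i) is) in
      (if odd n then (-1) ^ (p * (p - 1) div 2) else 1)
        / fact (length is) * (\<Sum>\<beta> | gw \<beta> is \<noteq> 0. gw \<beta> is))"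

text \<open>The word function of \<open>s\<^sup>k\<close>, where \<open>s = (-1)\<^sup>n/2 \<Sum> Q i j t\<^sup>i t\<^sup>j\<close>.\<close>

definition s_power_word ::
  "nat \<Rightarrow> nat \<Rightarrow> (nat \<Rightarrow> nat \<Rightarrow> complex) \<Rightarrow> nat \<Rightarrow> nat list \<Rightarrow> complex" where
  "s_power_word n m Q k is =
     (if length is = 2 * k \<and> set is \<subseteq> {n+1..n+m}
      then (\<Prod>j<k. (-1) ^ n / 2 * Q (is ! (2 * j)) (is ! (2 * j + 1))) else 0)"

definition s_power_zero :: "nat \<Rightarrow> nat \<Rightarrow> (nat \<Rightarrow> nat \<Rightarrow> complex) \<Rightarrow> nat \<Rightarrow> bool" where
  "s_power_zero n m Q k \<longleftrightarrow> (\<forall>\<mu>. super_coeff n (s_power_word n m Q k) \<mu> = 0)"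

lemma s_power_zero_odd:
  assumes "odd n" "m < 2 * k"
  shows "s_power_zero n m Q k"
  unfolding s_power_zero_def super_coeff_def
proof (intro allI sum.neutral ballI)
  fix \<mu> and js :: "nat list"
  show "super_sign n js * s_power_word n m Q k js = 0"
  proof (cases "length js = 2 * k \<and> set js \<subseteq> {n+1..n+m}")
    case True
    have "card (set js) \<le> m"
      using card_mono[of "{n+1..n+m}" "set js"] True by simp
    then have "\<not> distinct js"
      using True assms(2) distinct_card[of js] by auto
    moreover have "filter (\<lambda>i. n < i) js = js"
      using True by (intro filter_True) auto
    ultimately show ?thesis
      using assms(1) by (simp add: super_sign_def)
  next
    case False
    then show ?thesis by (auto simp: s_power_word_def)
  qed
qed


section \<open>Power series in the ambient coordinates and \<open>s\<close>\<close>

text \<open>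
  \<open>F \<mu>\<close> is the coefficient of the monomial \<open>\<mu>\<close> in \<open>t\<^sup>0, \<dots>, t\<^sup>n\<close>, a power series in \<open>s\<close>.
\<close>

type_synonym ts_series = "nat multiset \<Rightarrow> complex fps"

definition ts_times :: "ts_series \<Rightarrow> ts_series \<Rightarrow> ts_series"  (infixl "\<odot>" 70) where
  "(F \<odot> G) \<mu> = (\<Sum>\<nu> | \<nu> \<subseteq># \<mu>. F \<nu> * G (\<mu> - \<nu>))"

definition dt :: "nat \<Rightarrow> ts_series \<Rightarrow> ts_series" where
  "dt i F \<mu> = of_nat (count \<mu> i + 1) * F (add_mset i \<mu>)"

definition ds :: "ts_series \<Rightarrow> ts_series" where
  "ds F \<mu> = fps_deriv (F \<mu>)"

definition t_mult :: "nat \<Rightarrow> ts_series \<Rightarrow> ts_series" where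
  "t_mult i F \<mu> = (if i \<in># \<mu> then F (\<mu> - {#i#}) else 0)"

definition s_mult :: "ts_series \<Rightarrow> ts_series" where
  "s_mult F \<mu> = fps_X * F \<mu>"

definition restrict_s0 :: "ts_series \<Rightarrow> nat multiset \<Rightarrow> complex" where
  "restrict_s0 F \<mu> = fps_nth (F \<mu>) 0"

text \<open>
  The generating function of the invariants, as a series in \<open>t\<^sup>0, \<dots>, t\<^sup>n, s\<close> (it is one by monodromy
  invariance).  The coefficient of \<open>s\<^sup>k\<close> has no meaning if \<open>s\<^sup>k = 0\<close> and is then taken to be zero.
  Since \<open>Q\<close> is nondegenerate, for \<open>m > 0\<close> this means that \<open>F\<close> has degree at most \<open>m/2\<close> in \<open>s\<close> if \<open>n\<close>
  is odd (see \<open>s_power_zero_odd\<close>) and is no condition if \<open>n\<close> is even.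
\<close>

definition gw_potential ::
  "nat \<Rightarrow> nat \<Rightarrow> (nat \<Rightarrow> nat \<Rightarrow> complex) \<Rightarrow> (nat \<Rightarrow> nat list \<Rightarrow> complex) \<Rightarrow> ts_series \<Rightarrow> bool" where
  "gw_potential n m Q gw F \<longleftrightarrow>
     (\<forall>\<mu>. set_mset \<mu> \<subseteq> {..n+m} \<longrightarrow>
        super_coeff n (gw_word n gw) \<mu> =
          (\<Sum>k\<le>size \<mu>. fps_nth (F {#i \<in># \<mu>. i \<le> n#}) k
             * super_coeff n (s_power_word n m Q k) {#i \<in># \<mu>. n < i#})) \<and>
     (\<forall>\<mu>. \<not> set_mset \<mu> \<subseteq> {..n} \<longrightarrow> F \<mu> = 0) \<and>
     (\<forall>k. s_power_zero n m Q k \<longrightarrow> (\<forall>\<mu>. fps_nth (F \<mu>) k = 0))"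

lemma gw_potential_s0:
  assumes "gw_potential n m Q gw F" "set_mset \<mu> \<subseteq> {..n}"
  shows "restrict_s0 F \<mu> =
    (\<Sum>is\<in>permutations_of_multiset \<mu>. (\<Sum>\<beta> | gw \<beta> is \<noteq> 0. gw \<beta> is) / fact (size \<mu>))"
proof -
  have f1: "{#i \<in># \<mu>. i \<le> n#} = \<mu>"
    using assms(2) by (subst filter_mset_eq_conv) auto
  have f2: "{#i \<in># \<mu>. n < i#} = {#}"
    using assms(2) by (subst filter_mset_eq_conv) auto
  have s0: "super_coeff n (s_power_word n m Q k) {#} = (if k = 0 then 1 else 0)" for k
    by (auto simp: super_coeff_def super_sign_def s_power_word_def)
  have fl: "filter (\<lambda>i. n < i) js = []" if "js \<in> permutations_of_multiset \<mu>" for js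
  proof -
    have "set js \<subseteq> {..n}"
      using permutations_of_multisetD[OF that] assms(2) set_mset_mset[of js] by simp
    then show ?thesis by (auto simp: filter_empty_conv)
  qed
  have len: "length js = size \<mu>" if "js \<in> permutations_of_multiset \<mu>" for js
    using permutations_of_multisetD[OF that] by auto
  have "set_mset \<mu> \<subseteq> {..n+m}" using assms(2) by auto
  then have "super_coeff n (gw_word n gw) \<mu> =
      (\<Sum>k\<le>size \<mu>. fps_nth (F {#i \<in># \<mu>. i \<le> n#}) k
         * super_coeff n (s_power_word n m Q k) {#i \<in># \<mu>. n < i#})"
    using assms(1) unfolding gw_potential_def by blast
  also have "\<dots> = (\<Sum>k\<le>size \<mu>. if k = 0 then fps_nth (F \<mu>) 0 else 0)"
    unfolding f1 f2 s0 by (intro sum.cong) auto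
  also have "\<dots> = restrict_s0 F \<mu>"
    by (simp add: restrict_s0_def)
  finally have "restrict_s0 F \<mu> = super_coeff n (gw_word n gw) \<mu>" by simp
  also have "\<dots> = (\<Sum>is\<in>permutations_of_multiset \<mu>. (\<Sum>\<beta> | gw \<beta> is \<noteq> 0. gw \<beta> is) / fact (size \<mu>))"
    unfolding super_coeff_def
    by (intro sum.cong) (simp_all add: super_sign_def gw_word_def fl len)
  finally show ?thesis .
qed

text \<open>
  The form \<open>c = 1/6 \<Sum> t\<^sup>i t\<^sup>j t\<^sup>k \<integral> \<gamma>\<^sub>i \<gamma>\<^sub>j \<gamma>\<^sub>k\<close>.  The terms with two primitive indices add up to
  \<open>1/2 t\<^sup>0 \<Sum> Q i j t\<^sup>i t\<^sup>j = (-1)\<^sup>n t\<^sup>0 s\<close>.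
\<close>

definition classical_cubic :: "nat \<Rightarrow> nat list \<Rightarrow> ts_series" where
  "classical_cubic n d \<mu> =
     (if size \<mu> = 3 \<and> set_mset \<mu> \<subseteq> {..n}
      then fps_const (1 / 6 *
        (\<Sum>is\<in>permutations_of_multiset \<mu>. intersection_number n d (\<lambda>_ _. 0) is))
      else 0)
     + (if \<mu> = {#0#} then (-1) ^ n * fps_X else 0)"

definition equation_A :: "nat \<Rightarrow> nat list \<Rightarrow> nat \<Rightarrow> ts_series \<Rightarrow> bool" where
  "equation_A n d m F \<longleftrightarrow>
     (\<forall>a\<le>n. \<forall>b\<le>n. \<forall>\<mu> j. (odd n \<longrightarrow> j < m div 2) \<longrightarrow>
        fps_nth
          ((\<Sum>e\<le>n. \<Sum>f\<le>n. fps_const (ambient_metric_inv n d e f)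
              * (dt a (dt b (dt e F)) \<odot> dt f (ds F)) \<mu>)
           + 2 * s_mult (dt a (dt b (ds F)) \<odot> ds (ds F)) \<mu>) j
        = fps_nth ((dt a (ds F) \<odot> dt b (ds F)) \<mu>) j)"

definition euler_field :: "nat \<Rightarrow> nat list \<Rightarrow> ts_series \<Rightarrow> ts_series" where
  "euler_field n d F \<mu> =
     (\<Sum>i\<le>n. of_int (1 - int i) * t_mult i (dt i F) \<mu>)
     + of_int (2 - int n) * s_mult (ds F) \<mu>
     + of_int (fano_index n d) * dt 1 F \<mu>"

definition equation_E :: "nat \<Rightarrow> nat list \<Rightarrow> ts_series \<Rightarrow> bool" where
  "equation_E n d F \<longleftrightarrow>
     (\<forall>\<mu>. euler_field n d F \<mu> =
        of_int (3 - int n) * F \<mu> + of_int (fano_index n d) * dt 1 (classical_cubic n d) \<mu>)"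

end

theory Submission
  imports Defs
begin

unbundle fps_syntax

text \<open>
  Compare two solutions at the lowest coefficient of \<open>\<mu> s\<^sup>k\<close>, first by \<open>k\<close> and then by the size of \<open>\<mu>\<close>, where
  they might differ.  At \<open>\<mu> = 1\<close> the dimension constraint says that the gcd of \<open>n - 2\<close> and the Fano index divides \<open>1\<close>, so both
  coefficients vanish.  Otherwise let \<open>v\<^sub>f\<close> be the difference of the \<open>t\<^sup>f\<close>-derivatives of the two
  solutions at \<open>\<nu> s\<^sup>k\<close>, let \<open>\<phi>\<^sub>f\<close> be the value of \<open>F\<^sub>s\<^sub>f\<close> at the origin and let \<open>K\<^sub>a\<^sub>b\<^sup>f\<close> be the structure constants
  of the small ambient quantum product.  Then (A) gives \<open>K\<^sub>a\<^sub>b\<^sup>f \<phi>\<^sub>f = \<phi>\<^sub>a \<phi>\<^sub>b\<close> and \<open>K\<^sub>a\<^sub>b\<^sup>f v\<^sub>f = v\<^sub>a \<phi>\<^sub>b + \<phi>\<^sub>a v\<^sub>b\<close>.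
  Here \<open>\<phi>\<^sub>1 = 0\<close> since the Fano index exceeds \<open>1\<close>, and \<open>v\<^sub>1 = 0\<close> by (E).  By the dimension constraint the matrix \<open>K\<^sub>1\<close>, multiplication
  by the hyperplane class, is Hessenberg with nonzero off-diagonal, so its rows \<open>b < n\<close> determine a
  kernel vector by its first entry.  So \<open>\<phi>\<close>, the case \<open>k = 1\<close>, \<open>\<nu> = 1\<close> where (A) is not linear, is determined
  by \<open>\<phi>\<^sub>0\<close>, which \<open>\<beta> = 0\<close> invariants give; in all other cases \<open>\<phi>\<^sub>0 v = v\<^sub>0 \<phi>\<close>.  For \<open>a = b = 0\<close> this yields
  \<open>v\<^sub>0 \<phi>\<^sub>0\<^sup>2 = 2 v\<^sub>0 \<phi>\<^sub>0\<^sup>2\<close>, and \<open>\<phi>\<^sub>0 \<noteq> 0\<close> because \<open>Q \<noteq> 0\<close>, so \<open>v = 0\<close>.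
\<close>

lemma super_coeff_s_power_nonzero:
  assumes "super_coeff n (s_power_word n m Q k) \<nu> \<noteq> 0"
  shows "size \<nu> = 2 * k \<and> set_mset \<nu> \<subseteq> {n+1..n+m}"
proof -
  obtain js where js: "js \<in> permutations_of_multiset \<nu>" "s_power_word n m Q k js \<noteq> 0"
    using assms unfolding super_coeff_def by (metis (no_types, lifting) mult_zero_right sum.neutral)
  then have "mset js = \<nu>" by (simp add: permutations_of_multiset_def)
  moreover have "length js = 2 * k \<and> set js \<subseteq> {n+1..n+m}"
    using js(2) by (auto simp: s_power_word_def split: if_splits)
  ultimately show ?thesis by auto
qed

lemma gw_potential_coeff:
  assumes "gw_potential n m Q gw F" "set_mset \<mu> \<subseteq> {..n}"
    and "size \<nu> = 2 * k" "set_mset \<nu> \<subseteq> {n+1..n+m}"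
  shows "super_coeff n (gw_word n gw) (\<mu> + \<nu>) = F \<mu> $ k * super_coeff n (s_power_word n m Q k) \<nu>"
proof -
  have "filter_mset (\<lambda>i. i \<le> n) \<mu> = \<mu>" "filter_mset (\<lambda>i. n < i) \<nu> = \<nu>"
    using assms(2,4) by (auto simp: filter_mset_eq_conv)
  moreover have "filter_mset (\<lambda>i. i \<le> n) \<nu> = {#}" "filter_mset (\<lambda>i. n < i) \<mu> = {#}"
    using assms(2,4) by (auto simp: filter_mset_eq_conv)
  ultimately have f: "filter_mset (\<lambda>i. i \<le> n) (\<mu> + \<nu>) = \<mu>" "filter_mset (\<lambda>i. n < i) (\<mu> + \<nu>) = \<nu>"
    by simp_all
  have "set_mset (\<mu> + \<nu>) \<subseteq> {..n+m}" using assms(2,4) by auto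
  then have "super_coeff n (gw_word n gw) (\<mu> + \<nu>) =
      (\<Sum>j\<le>size (\<mu> + \<nu>). F \<mu> $ j * super_coeff n (s_power_word n m Q j) \<nu>)"
    using assms(1) f unfolding gw_potential_def by metis
  also have "\<dots> = (\<Sum>j\<le>size (\<mu> + \<nu>). if j = k then F \<mu> $ k * super_coeff n (s_power_word n m Q k) \<nu> else 0)"
    using super_coeff_s_power_nonzero[of n m Q _ \<nu>] assms(3) by (intro sum.cong) auto
  also have "\<dots> = F \<mu> $ k * super_coeff n (s_power_word n m Q k) \<nu>"
    using assms(3) by simp
  finally show ?thesis .
qed

lemma sum_list_class_degree:
  assumes "mset js = \<mu> + \<nu>" "set_mset \<mu> \<subseteq> {..n}" "set_mset \<nu> \<subseteq> {n+1..n+m}"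
  shows "(\<Sum>i\<leftarrow>js. class_degree n i) = real (\<Sum>\<^sub># \<mu>) + real (size \<nu>) * real n / 2"
proof -
  have "(\<Sum>i\<leftarrow>js. class_degree n i) = \<Sum>\<^sub># (image_mset (class_degree n) (\<mu> + \<nu>))"
    by (metis assms(1) mset_map sum_mset_sum_list)
  moreover have "\<Sum>\<^sub># (image_mset (class_degree n) \<mu>) = real (\<Sum>\<^sub># \<mu>)"
    using assms(2) by (induction \<mu>) (auto simp: class_degree_def)
  moreover have "\<Sum>\<^sub># (image_mset (class_degree n) \<nu>) = real (size \<nu>) * real n / 2"
    using assms(3) by (induction \<nu>) (auto simp: class_degree_def field_simps)
  ultimately show ?thesis by simp
qed

lemma dimension_constraint_words:
  assumes "dimension_constraint n d m gw" "gw \<beta> js \<noteq> 0"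
    and "mset js = \<mu> + \<nu>" "set_mset \<mu> \<subseteq> {..n}"
    and "size \<nu> = 2 * k" "set_mset \<nu> \<subseteq> {n+1..n+m}"
  shows "int (\<Sum>\<^sub># \<mu>) + int k * (int n - 2) = int n - 3 + int (size \<mu>) + fano_index n d * int \<beta>"
proof -
  have "set js = set_mset (\<mu> + \<nu>)" using assms(3) by (metis set_mset_mset)
  then have "set js \<subseteq> {..n+m}" using assms(4,6) by auto
  then have "(\<Sum>i\<leftarrow>js. class_degree n i)
      = real n - 3 + real (length js) + of_int (fano_index n d) * real \<beta>"
    using assms(1,2) unfolding dimension_constraint_def by blast
  moreover have "length js = size \<mu> + 2 * k"
    using assms(3,5) by (metis size_mset size_union)
  ultimately have "real (\<Sum>\<^sub># \<mu>) + real k * real n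
      = real n - 3 + real (size \<mu> + 2 * k) + of_int (fano_index n d) * real \<beta>"
    using sum_list_class_degree[OF assms(3,4,6)] assms(5) by simp
  then have "real_of_int (int (\<Sum>\<^sub># \<mu>) + int k * (int n - 2))
      = real_of_int (int n - 3 + int (size \<mu>) + fano_index n d * int \<beta>)"
    by (simp add: algebra_simps del: of_nat_sum_mset)
  then show ?thesis by linarith
qed

lemma gw_potential_dimension:
  assumes "gw_potential n m Q gw F" "dimension_constraint n d m gw" "F \<mu> $ k \<noteq> 0"
  shows "\<exists>\<beta>. int (\<Sum>\<^sub># \<mu>) + int k * (int n - 2)
    = int n - 3 + int (size \<mu>) + fano_index n d * int \<beta>"
proof -
  have \<mu>: "set_mset \<mu> \<subseteq> {..n}" and "\<not> s_power_zero n m Q k"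
    using assms(1,3) unfolding gw_potential_def by (metis fps_zero_nth, metis)
  then obtain \<nu> where \<nu>: "super_coeff n (s_power_word n m Q k) \<nu> \<noteq> 0"
    unfolding s_power_zero_def by blast
  note \<nu>' = super_coeff_s_power_nonzero[OF \<nu>]
  have "super_coeff n (gw_word n gw) (\<mu> + \<nu>) \<noteq> 0"
    using gw_potential_coeff[OF assms(1) \<mu>] \<nu> \<nu>' assms(3) by simp
  then obtain js where js: "js \<in> permutations_of_multiset (\<mu> + \<nu>)" "gw_word n gw js \<noteq> 0"
    unfolding super_coeff_def by (metis (no_types, lifting) mult_zero_right sum.neutral)
  have "\<exists>\<beta>. gw \<beta> js \<noteq> 0"
    using js(2) by (rule contrapos_np) (simp add: gw_word_def)
  then obtain \<beta> where \<beta>: "gw \<beta> js \<noteq> 0" ..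
  have "mset js = \<mu> + \<nu>" using js(1) by (simp add: permutations_of_multiset_def)
  then show ?thesis
    using dimension_constraint_words[OF assms(2) \<beta> _ \<mu>] \<nu>' by blast
qed

lemma gw_sum_classical:
  assumes "dimension_constraint n d m gw" "classical_limit n d m Q gw" "fano_index n d > 0"
    and "mset js = \<mu> + \<nu>" "set_mset \<mu> \<subseteq> {..n}"
    and "size \<nu> = 2 * k" "set_mset \<nu> \<subseteq> {n+1..n+m}"
    and "int (\<Sum>\<^sub># \<mu>) + int k * (int n - 2) = int n - 3 + int (size \<mu>)"
  shows "(\<Sum>\<beta> | gw \<beta> js \<noteq> 0. gw \<beta> js) = (if length js = 3 then intersection_number n d Q js else 0)"
proof -
  have "set js = set_mset (\<mu> + \<nu>)" using assms(4) by (metis set_mset_mset)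
  then have "set js \<subseteq> {..n+m}" using assms(5,7) by auto
  then have gw0: "gw 0 js = (if length js = 3 then intersection_number n d Q js else 0)"
    using assms(2) by (simp add: classical_limit_def)
  have zero: "\<beta> = 0" if "gw \<beta> js \<noteq> 0" for \<beta>
    using dimension_constraint_words[OF assms(1) that assms(4-7)] assms(3,8) by simp
  show ?thesis
  proof (cases "gw 0 js = 0")
    case True
    with zero have "{\<beta>. gw \<beta> js \<noteq> 0} = {}" by (metis (mono_tags) Collect_empty_eq)
    with True gw0 show ?thesis by simp
  next
    case False
    with zero have "{\<beta>. gw \<beta> js \<noteq> 0} = {0}" by blast
    with gw0 show ?thesis by simp
  qed
qed

lemma card_permutations_of_multiset_pos:
  "card (permutations_of_multiset \<mu>) > 0"
  by (simp add: card_gt_0_iff)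

lemma gw_potential_classical_triple:
  assumes "gw_potential n m Q gw F" "dimension_constraint n d m gw" "classical_limit n d m Q gw"
    and "fano_index n d > 0" "\<forall>i\<in>set d. i \<ge> 2" "a + b + c = n"
  shows "F {#a, b, c#} $ 0 \<noteq> 0"
proof -
  let ?\<mu> = "{#a, b, c#}"
  have sub: "set_mset ?\<mu> \<subseteq> {..n}" using assms(6) by auto
  have "(\<Sum>\<beta> | gw \<beta> js \<noteq> 0. gw \<beta> js) = of_nat (prod_list d)"
    if "js \<in> permutations_of_multiset ?\<mu>" for js
  proof -
    have js: "mset js = ?\<mu>" using that by (simp add: permutations_of_multiset_def)
    have "(\<Sum>\<beta> | gw \<beta> js \<noteq> 0. gw \<beta> js)
        = (if length js = 3 then intersection_number n d Q js else 0)"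
      using gw_sum_classical[OF assms(2,3,4) _ sub, of js "{#}" 0] js assms(6)
      by (simp flip: of_nat_add)
    moreover have set: "set js = {a, b, c}" using js by (metis set_mset_mset set_mset_add_mset_insert set_mset_empty)
    moreover have "length js = 3" using js by (metis size_mset size_add_mset size_empty numeral_3_eq_3)
    moreover have "sum_list js = n" using js assms(6)
      by (metis sum_mset_sum_list sum_mset.add_mset sum_mset.empty add.assoc add_0_right)
    moreover have "filter (\<lambda>i. i \<le> n) js = js" "filter (\<lambda>i. n < i) js = []"
      using set assms(6) by (auto simp: filter_id_conv filter_empty_conv)
    ultimately show ?thesis by (simp add: intersection_number_def)
  qed
  then have "restrict_s0 F ?\<mu> = (\<Sum>js\<in>permutations_of_multiset ?\<mu>. of_nat (prod_list d) / fact (size ?\<mu>))"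
    unfolding gw_potential_s0[OF assms(1) sub] by (intro sum.cong) simp_all
  also have "\<dots> \<noteq> 0"
    using assms(5) card_permutations_of_multiset_pos[of ?\<mu>] by (auto simp: prod_list_zero_iff)
  finally show ?thesis by (simp add: restrict_s0_def)
qed

lemma primitive_pairing_entry:
  assumes "primitive_pairing n m Q" "m > 0"
  obtains i j where "i \<in> {n+1..n+m}" "j \<in> {n+1..n+m}" "i \<le> j" "Q i j \<noteq> 0"
proof (rule ccontr)
  assume "\<not> thesis"
  with that have le: "Q i j = 0" if "i \<in> {n+1..n+m}" "j \<in> {n+1..n+m}" "i \<le> j" for i j
    using that by blast
  have all: "Q i j = 0" if "i \<in> {n+1..n+m}" "j \<in> {n+1..n+m}" for i j
  proof (cases "i \<le> j")
    case False
    then have "Q j i = 0" using le that by simp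
    moreover have "Q i j = (-1) ^ n * Q j i"
      using assms(1) that unfolding primitive_pairing_def by blast
    ultimately show ?thesis by simp
  qed (use le that in blast)
  have "\<forall>j\<in>{n+1..n+m}. (\<Sum>i=n+1..n+m. 1 * Q i j) = 0"
    using all by (intro ballI sum.neutral) auto
  then have "\<forall>i\<in>{n+1..n+m}. (1::complex) = 0"
    using spec[OF conjunct2[OF assms(1)[unfolded primitive_pairing_def]], of "\<lambda>_. 1"] by (rule rev_mp)
  then show False using assms(2) by auto
qed

lemma super_sign_times_pairing:
  assumes "primitive_pairing n m Q" "i \<in> {n+1..n+m}" "j \<in> {n+1..n+m}" "i \<le> j"
    and "filter (\<lambda>i. n < i) js = [p, q]" "{#p, q#} = {#i, j#}"
  shows "super_sign n js * Q p q = Q i j"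
proof -
  have sym: "Q i j = (-1) ^ n * Q j i" if "i \<in> {n+1..n+m}" "j \<in> {n+1..n+m}" for i j
    using assms(1) that unfolding primitive_pairing_def by blast
  have pq: "p = i \<and> q = j \<or> p = j \<and> q = i"
    using assms(6) by (auto simp: add_eq_conv_diff)
  show ?thesis
  proof (cases "even n")
    case True
    then show ?thesis using pq sym[OF assms(2,3)] by (auto simp: super_sign_def)
  next
    case odd: False
    show ?thesis
    proof (cases "i = j")
      case True
      then have "Q i j = 0" using sym[OF assms(2,3)] odd by simp
      with True pq show ?thesis by auto
    next
      case False
      with assms(4) have "i < j" by simp
      have inv: "{(a, b). a < b \<and> b < length [p, q] \<and> [p, q] ! b < [p, q] ! a}
          = (if q < p then {(0, 1)} else {})"
        by (auto simp: less_Suc_eq)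
      show ?thesis
        using pq \<open>i < j\<close> odd sym[OF assms(2,3)]
        unfolding super_sign_def Let_def assms(5) inv by auto
    qed
  qed
qed

lemma gw_potential_unit_coeff_nonzero:
  assumes "gw_potential n m Q gw F" "dimension_constraint n d m gw" "classical_limit n d m Q gw"
    and "fano_index n d > 0" "primitive_pairing n m Q" "m > 0"
  shows "F {#0#} $ 1 \<noteq> 0"
proof -
  obtain i j where ij: "i \<in> {n+1..n+m}" "j \<in> {n+1..n+m}" "i \<le> j" "Q i j \<noteq> 0"
    using primitive_pairing_entry[OF assms(5,6)] .
  let ?\<mu> = "{#0#} + {#i, j#}"
  define c where "c = (if odd n then -1 else 1) / 6 * Q i j"
  have "super_sign n js * gw_word n gw js = c" if "js \<in> permutations_of_multiset ?\<mu>" for js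
  proof -
    have js: "mset js = ?\<mu>" using that by (simp add: permutations_of_multiset_def)
    have len: "length js = 3"
      using js by (metis size_mset size_add_mset size_empty numeral_3_eq_3 add_mset_add_single union_commute)
    then have gw: "(\<Sum>\<beta> | gw \<beta> js \<noteq> 0. gw \<beta> js) = intersection_number n d Q js"
      using gw_sum_classical[OF assms(2,3,4) js, of 1] ij by simp
    have "mset (filter (\<lambda>i. n < i) js) = {#i, j#}" "mset (filter (\<lambda>i. i \<le> n) js) = {#0#}"
      using js ij by auto
    moreover from this have "length (filter (\<lambda>i. n < i) js) = 2"
      by (metis size_mset size_add_mset size_empty numeral_2_eq_2)
    ultimately obtain p q where pq: "filter (\<lambda>i. n < i) js = [p, q]" "{#p, q#} = {#i, j#}"
        "filter (\<lambda>i. i \<le> n) js = [0]"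
      by (auto simp: numeral_2_eq_2 length_Suc_conv simp flip: mset_filter)
    have word: "gw_word n gw js = (if odd n then -1 else 1) / 6 * Q p q"
      unfolding gw_word_def gw Let_def
      by (simp add: pq len intersection_number_def fact_numeral)
    have "super_sign n js * gw_word n gw js = (if odd n then -1 else 1) / 6 * (super_sign n js * Q p q)"
      by (simp only: word ac_simps)
    then show ?thesis
      by (simp only: super_sign_times_pairing[OF assms(5) ij(1-3) pq(1,2)] c_def)
  qed
  then have "super_coeff n (gw_word n gw) ?\<mu> = of_nat (card (permutations_of_multiset ?\<mu>)) * c"
    unfolding super_coeff_def by simp
  also have "\<dots> \<noteq> 0"
    using ij(4) card_permutations_of_multiset_pos[of ?\<mu>] by (simp add: c_def)
  finally show ?thesis
    using gw_potential_coeff[OF assms(1), of "{#0#}" "{#i, j#}" 1] ij by auto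
qed

lemma gw_potential_unit_coeff_unique:
  assumes "gw_potential n m Q gw F" "dimension_constraint n d m gw" "classical_limit n d m Q gw"
    and "gw_potential n m Q gw' F'" "dimension_constraint n d m gw'" "classical_limit n d m Q gw'"
    and "fano_index n d > 0"
  shows "F {#0#} $ 1 = F' {#0#} $ 1"
proof (cases "s_power_zero n m Q 1")
  case True
  then show ?thesis using assms(1,4) by (simp add: gw_potential_def)
next
  case False
  then obtain \<nu> where \<nu>: "super_coeff n (s_power_word n m Q 1) \<nu> \<noteq> 0"
    unfolding s_power_zero_def by blast
  then have \<nu>': "size \<nu> = 2 * 1" "set_mset \<nu> \<subseteq> {n+1..n+m}"
    using super_coeff_s_power_nonzero by blast+
  have *: "gw_word n gw js = (let p = length (filter (\<lambda>i. n < i) js) in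
      (if odd n then (-1) ^ (p * (p - 1) div 2) else 1) / fact (length js) * intersection_number n d Q js)"
    if "dimension_constraint n d m gw" "classical_limit n d m Q gw"
      "js \<in> permutations_of_multiset ({#0#} + \<nu>)" for gw js
  proof -
    have js: "mset js = {#0#} + \<nu>" using that by (simp add: permutations_of_multiset_def)
    have "length js = 3" using js \<nu>'(1) by (metis One_nat_def Suc_1 size_mset size_union size_single nat_mult_1_right numeral_3_eq_3 plus_1_eq_Suc)
    then show ?thesis
      using gw_sum_classical[OF that(1,2) assms(7) js _ \<nu>'] by (simp add: gw_word_def Let_def)
  qed
  have "super_coeff n (gw_word n gw) ({#0#} + \<nu>) = super_coeff n (gw_word n gw') ({#0#} + \<nu>)"
    unfolding super_coeff_def using *[OF assms(2,3)] *[OF assms(5,6)] by (intro sum.cong) auto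
  then show ?thesis
    using gw_potential_coeff[OF assms(1) _ \<nu>', of "{#0#}"] gw_potential_coeff[OF assms(4) _ \<nu>', of "{#0#}"] \<nu>
    by simp
qed

lemma finite_submultisets: "finite {\<nu>. \<nu> \<subseteq># \<mu>}"
proof (rule finite_surj)
  show "finite {xs. set xs \<subseteq> set_mset \<mu> \<and> length xs \<le> size \<mu>}"
    by (intro finite_lists_length_le) simp
  show "{\<nu>. \<nu> \<subseteq># \<mu>} \<subseteq> mset ` {xs. set xs \<subseteq> set_mset \<mu> \<and> length xs \<le> size \<mu>}"
  proof
    fix \<nu> assume "\<nu> \<in> {\<nu>. \<nu> \<subseteq># \<mu>}"
    moreover obtain xs where "\<nu> = mset xs" by (metis ex_mset)
    ultimately show "\<nu> \<in> mset ` {xs. set xs \<subseteq> set_mset \<mu> \<and> length xs \<le> size \<mu>}"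
      using set_mset_mono[of \<nu> \<mu>] size_mset_mono[of \<nu> \<mu>] by auto
  qed
qed

lemma nth_ts_times:
  "(P \<odot> R) \<mu> $ l = (\<Sum>(\<nu>, i)\<in>{\<nu>. \<nu> \<subseteq># \<mu>} \<times> {..l}. P \<nu> $ i * R (\<mu> - \<nu>) $ (l - i))"
  by (simp add: ts_times_def fps_sum_nth fps_mult_nth atLeast0AtMost sum.cartesian_product)

lemma nth_ts_times_diff:
  assumes P: "\<And>\<nu> i. \<nu> \<subseteq># \<mu> \<Longrightarrow> i \<le> l \<Longrightarrow> (\<nu>, i) \<noteq> (\<mu>, l) \<Longrightarrow> P \<nu> $ i = P' \<nu> $ i"
    and R: "\<And>\<nu> i. \<nu> \<subseteq># \<mu> \<Longrightarrow> i \<le> l \<Longrightarrow> (\<nu>, i) \<noteq> (\<mu>, l) \<Longrightarrow> R \<nu> $ i = R' \<nu> $ i"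
    and ne: "(\<mu>, l) \<noteq> ({#}, 0)"
  shows "(P \<odot> R) \<mu> $ l - (P' \<odot> R') \<mu> $ l
      = (P \<mu> $ l - P' \<mu> $ l) * R {#} $ 0 + P {#} $ 0 * (R \<mu> $ l - R' \<mu> $ l)"
proof -
  let ?S = "{\<nu>. \<nu> \<subseteq># \<mu>} \<times> {..l}"
  let ?t = "\<lambda>(\<nu>, i). P \<nu> $ i * R (\<mu> - \<nu>) $ (l - i) - P' \<nu> $ i * R' (\<mu> - \<nu>) $ (l - i)"
  have fin: "finite ?S" by (simp add: finite_submultisets)
  have "(P \<odot> R) \<mu> $ l - (P' \<odot> R') \<mu> $ l = sum ?t ?S"
    unfolding nth_ts_times sum_subtractf[symmetric] by (intro sum.cong) auto
  also have "\<dots> = sum ?t {(\<mu>, l), ({#}, 0)}"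
  proof (intro sum.mono_neutral_right[OF fin] ballI)
    fix x assume x: "x \<in> ?S - {(\<mu>, l), ({#}, 0)}"
    obtain \<nu> i where [simp]: "x = (\<nu>, i)" by fastforce
    have *: "\<nu> \<subseteq># \<mu>" "i \<le> l" "(\<nu>, i) \<noteq> (\<mu>, l)" "(\<nu>, i) \<noteq> ({#}, 0)" using x by auto
    have "(\<mu> - \<nu>, l - i) \<noteq> (\<mu>, l)"
    proof
      assume "(\<mu> - \<nu>, l - i) = (\<mu>, l)"
      then have "size \<mu> = size \<mu> - size \<nu>" "i = 0"
        using *(1,2) by (auto simp flip: size_Diff_submset)
      then have "size \<nu> = 0" using size_mset_mono[OF *(1)] by linarith
      then have "\<nu> = {#}" by simp
      with *(4) \<open>i = 0\<close> show False by simp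
    qed
    then show "?t x = 0"
      using P[of \<nu> i] R[of "\<mu> - \<nu>" "l - i"] * by simp
  qed auto
  also have "\<dots> = (P \<mu> $ l - P' \<mu> $ l) * R {#} $ 0 + P {#} $ 0 * (R \<mu> $ l - R' \<mu> $ l)"
    using ne P[of "{#}" 0] R[of "{#}" 0] by (auto simp: algebra_simps)
  finally show ?thesis .
qed

lemma euler_field_nth:
  assumes "set_mset \<mu> \<subseteq> {..n}"
  shows "euler_field n d F \<mu> $ k = ((\<Sum>i\<le>n. of_int (1 - int i) * of_nat (count \<mu> i)) + of_int (2 - int n) * of_nat k) * F \<mu> $ k
    + of_int (fano_index n d) * of_nat (count \<mu> 1 + 1) * F (add_mset 1 \<mu>) $ k"
proof -
  have "t_mult i (dt i F) \<mu> = of_nat (count \<mu> i) * F \<mu>" for i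
    by (cases "i \<in># \<mu>") (auto simp: t_mult_def dt_def count_eq_zero_iff)
  then show ?thesis
    by (cases k) (simp_all add: euler_field_def dt_def s_mult_def ds_def fps_sum_nth sum_distrib_left sum_distrib_right
        algebra_simps flip: fps_of_nat fps_of_int)
qed

lemma dt_nth: "dt i F \<mu> $ k = of_nat (count \<mu> i + 1) * F (add_mset i \<mu>) $ k"
  by (simp add: dt_def flip: fps_of_nat)

lemma dt_dt_dt_nth:
  "dt a (dt b (dt e F)) {#} $ k
    = of_nat ((count {#a#} b + 1) * (count {#b, a#} e + 1)) * F {#e, b, a#} $ k"
  unfolding dt_nth of_nat_mult by simp

lemma ds_nth: "ds F \<mu> $ k = of_nat (k + 1) * F \<mu> $ (k + 1)"
  by (simp add: ds_def)

definition ambient_product :: "nat \<Rightarrow> nat list \<Rightarrow> ts_series \<Rightarrow> nat \<Rightarrow> nat \<Rightarrow> nat \<Rightarrow> complex" where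
  "ambient_product n d F a b f =
     (\<Sum>e\<le>n. ambient_metric_inv n d e f * dt a (dt b (dt e F)) {#} $ 0)"

lemma ambient_product_cong:
  assumes "restrict_s0 F = restrict_s0 F'"
  shows "ambient_product n d F = ambient_product n d F'"
proof -
  have "F \<mu> $ 0 = F' \<mu> $ 0" for \<mu>
    using fun_cong[OF assms, of \<mu>] by (simp add: restrict_s0_def)
  then show ?thesis by (simp add: ambient_product_def dt_nth fun_eq_iff)
qed

lemma ambient_product_eq:
  assumes "f \<le> n"
  shows "ambient_product n d F a b f = dt a (dt b (dt (n - f) F)) {#} $ 0 / of_nat (prod_list d)"
proof -
  have "ambient_product n d F a b f
      = (\<Sum>e\<le>n. if e = n - f then dt a (dt b (dt (n - f) F)) {#} $ 0 / of_nat (prod_list d) else 0)"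
    unfolding ambient_product_def using assms
    by (intro sum.cong) (auto simp: ambient_metric_inv_def)
  then show ?thesis by simp
qed

lemma ambient_product_hyperplane_diag:
  assumes "gw_potential n m Q gw F" "dimension_constraint n d m gw" "classical_limit n d m Q gw"
    and "fano_index n d > 0" "\<forall>i\<in>set d. i \<ge> 2" "b < n"
  shows "ambient_product n d F 1 b (Suc b) \<noteq> 0"
proof -
  have "F {#n - Suc b, b, 1#} $ 0 \<noteq> 0"
    using gw_potential_classical_triple[OF assms(1-5)] assms(6) by simp
  moreover have "prod_list d \<noteq> 0" using assms(5) by (auto simp: prod_list_zero_iff)
  ultimately show ?thesis
    using assms(6) by (simp add: ambient_product_eq dt_dt_dt_nth del: of_nat_add of_nat_mult of_nat_Suc)
qed

lemma ambient_product_hyperplane_above: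
  assumes "gw_potential n m Q gw F" "dimension_constraint n d m gw"
    and "fano_index n d > 0" "Suc b < f" "f \<le> n"
  shows "ambient_product n d F 1 b f = 0"
proof -
  have "F {#n - f, b, 1#} $ 0 = 0"
  proof (rule ccontr)
    assume "F {#n - f, b, 1#} $ 0 \<noteq> 0"
    from gw_potential_dimension[OF assms(1,2) this]
    obtain \<beta> where "1 + (int (n - f) + int b) = int n + fano_index n d * int \<beta>" by auto
    moreover have "fano_index n d * int \<beta> \<ge> 0" using assms(3) by simp
    ultimately show False using assms(4,5) by simp
  qed
  then show ?thesis using assms(5) by (simp add: ambient_product_eq dt_dt_dt_nth)
qed

lemma hessenberg_kernel:
  fixes K :: "nat \<Rightarrow> nat \<Rightarrow> 'a::idom"
  assumes "\<And>b. b < n \<Longrightarrow> K b (Suc b) \<noteq> 0"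
    and "\<And>b f. Suc b < f \<Longrightarrow> f \<le> n \<Longrightarrow> K b f = 0"
    and "\<And>b. b < n \<Longrightarrow> (\<Sum>f\<le>n. K b f * w f) = 0"
    and "w 0 = 0" "f \<le> n"
  shows "w f = 0"
  using assms(5)
proof (induction f rule: less_induct)
  case (less f)
  show ?case
  proof (cases f)
    case 0
    with assms(4) show ?thesis by simp
  next
    case (Suc b)
    have "K b g * w g = (if g = f then K b f * w f else 0)" if "g \<le> n" for g
      using less assms(2)[of b g] that Suc by (cases g f rule: linorder_cases) auto
    then have "(\<Sum>g\<le>n. K b g * w g) = (\<Sum>g\<le>n. if g = f then K b f * w f else 0)"
      by (intro sum.cong) auto
    then have "K b f * w f = 0" using assms(3)[of b] less.prems Suc by simp
    then show ?thesis using assms(1)[of b] less.prems Suc by simp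
  qed
qed

lemma equation_A_at_origin:
  assumes "equation_A n d m F" "odd n \<longrightarrow> 0 < m div 2" "a \<le> n" "b \<le> n"
  shows "(\<Sum>f\<le>n. ambient_product n d F a b f * F {#f#} $ 1) = F {#a#} $ 1 * F {#b#} $ 1"
proof -
  have sub: "{\<nu>::nat multiset. \<nu> \<subseteq># {#}} = {{#}}" by auto
  have "(\<Sum>e\<le>n. \<Sum>f\<le>n. ambient_metric_inv n d e f * (dt a (dt b (dt e F)) {#} $ 0 * F {#f#} $ 1))
      = F {#a#} $ 1 * F {#b#} $ 1"
    using assms(1)[unfolded equation_A_def, rule_format, of a b 0 "{#}"] assms(2-)
    by (simp add: fps_sum_nth nth_ts_times sub s_mult_def dt_nth ds_nth numeral_fps_const)
  then show ?thesis
    by (subst (asm) sum.swap) (simp add: ambient_product_def sum_distrib_right mult.assoc)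
qed

text \<open>
  The \<open>F\<^sub>s\<^sub>s\<close>-term of (A) carries a factor \<open>s\<close>, so at \<open>\<nu> s\<^sup>k\<^sup>-\<^sup>1\<close> it only contains coefficients on which \<open>F\<close> and
  \<open>F'\<close> agree already; in the other two products the unknowns are paired with values at the origin.
\<close>

lemma equation_A_linearized:
  assumes A: "equation_A n d m F" "equation_A n d m F'"
    and k: "k \<ge> 1" "odd n \<longrightarrow> k \<le> m div 2" "(\<nu>, k) \<noteq> ({#}, 1)"
    and lower: "\<And>j \<mu>. j < k \<Longrightarrow> F \<mu> $ j = F' \<mu> $ j"
    and smaller: "\<And>\<mu>. size \<mu> \<le> size \<nu> \<Longrightarrow> F \<mu> $ k = F' \<mu> $ k"
    and ab: "a \<le> n" "b \<le> n"
    and v: "\<And>f. v f = of_nat (count \<nu> f + 1) * (F (add_mset f \<nu>) $ k - F' (add_mset f \<nu>) $ k)"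
  shows "(\<Sum>f\<le>n. ambient_product n d F a b f * v f) = v a * F {#b#} $ 1 + F {#a#} $ 1 * v b"
proof -
  obtain l where l: "k = Suc l" using k(1) by (cases k) auto
  have ne: "(\<nu>, l) \<noteq> ({#}, 0)" using k(3) l by auto
  have agree: "dt f (ds F) \<mu> $ i = dt f (ds F') \<mu> $ i"
    if "\<mu> \<subseteq># \<nu>" "i \<le> l" "(\<mu>, i) \<noteq> (\<nu>, l)" for f \<mu> i
  proof (cases "i = l")
    case True
    with that have "\<mu> \<subset># \<nu>" by (simp add: subset_mset.less_le)
    then have "size \<mu> < size \<nu>" by (rule mset_subset_size)
    then have "F (add_mset f \<mu>) $ k = F' (add_mset f \<mu>) $ k" by (intro smaller) simp
    with True l show ?thesis by (simp add: dt_nth ds_nth)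
  next
    case False
    with that have "Suc i < k" using l by simp
    with lower show ?thesis by (simp add: dt_nth ds_nth)
  qed
  have diff: "dt f (ds F) \<nu> $ l - dt f (ds F') \<nu> $ l = of_nat k * v f" for f
    using l by (simp add: dt_nth ds_nth v algebra_simps)
  have unit: "dt f (ds F) {#} $ 0 = F {#f#} $ 1" for f
    by (simp add: dt_nth ds_nth)
  have ambient: "(dt a (dt b (dt e F)) \<odot> dt f (ds F)) \<nu> $ l - (dt a (dt b (dt e F')) \<odot> dt f (ds F')) \<nu> $ l
      = dt a (dt b (dt e F)) {#} $ 0 * (of_nat k * v f)" for e f
  proof -
    have lower': "dt a (dt b (dt e F)) \<mu> $ i = dt a (dt b (dt e F')) \<mu> $ i" if "i \<le> l" for \<mu> i
      using lower that l by (simp add: dt_nth)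
    have "(dt a (dt b (dt e F)) \<odot> dt f (ds F)) \<nu> $ l - (dt a (dt b (dt e F')) \<odot> dt f (ds F')) \<nu> $ l
        = (dt a (dt b (dt e F)) \<nu> $ l - dt a (dt b (dt e F')) \<nu> $ l) * dt f (ds F) {#} $ 0
          + dt a (dt b (dt e F)) {#} $ 0 * (dt f (ds F) \<nu> $ l - dt f (ds F') \<nu> $ l)"
      by (rule nth_ts_times_diff) (use lower' agree ne in blast)+
    with lower' diff show ?thesis by simp
  qed
  have prim: "(2 * s_mult (dt a (dt b (ds F)) \<odot> ds (ds F)) \<nu>) $ l
      = (2 * s_mult (dt a (dt b (ds F')) \<odot> ds (ds F')) \<nu>) $ l"
  proof (cases l)
    case 0
    then show ?thesis by (simp add: s_mult_def numeral_fps_const)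
  next
    case (Suc q)
    have "dt a (dt b (ds F)) \<mu> $ i * ds (ds F) (\<nu> - \<mu>) $ (q - i)
        = dt a (dt b (ds F')) \<mu> $ i * ds (ds F') (\<nu> - \<mu>) $ (q - i)" if "i \<le> q" for \<mu> i
    proof -
      have "F (\<nu> - \<mu>) $ (q - i + 2) = F' (\<nu> - \<mu>) $ (q - i + 2)"
      proof (cases "i = 0")
        case True
        then show ?thesis using smaller[of "\<nu> - \<mu>"] Suc l by (simp add: size_mset_mono)
      qed (use lower that Suc l in simp)
      then show ?thesis using lower[of "Suc i"] that Suc l by (simp add: dt_nth ds_nth)
    qed
    then have "(dt a (dt b (ds F)) \<odot> ds (ds F)) \<nu> $ q = (dt a (dt b (ds F')) \<odot> ds (ds F')) \<nu> $ q"
      unfolding nth_ts_times by (intro sum.cong) auto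
    then show ?thesis using Suc by (simp add: s_mult_def numeral_fps_const)
  qed
  have eqn: "(\<Sum>e\<le>n. \<Sum>f\<le>n. ambient_metric_inv n d e f * (dt a (dt b (dt e G)) \<odot> dt f (ds G)) \<nu> $ l)
      + (2 * s_mult (dt a (dt b (ds G)) \<odot> ds (ds G)) \<nu>) $ l = (dt a (ds G) \<odot> dt b (ds G)) \<nu> $ l"
    if "equation_A n d m G" for G
    using that[unfolded equation_A_def, rule_format, of a b l \<nu>] ab k(2) l
    by (simp add: fps_sum_nth Suc_le_eq)
  have "(\<Sum>e\<le>n. \<Sum>f\<le>n. ambient_metric_inv n d e f * (dt a (dt b (dt e F)) {#} $ 0 * (of_nat k * v f)))
      = (dt a (ds F) \<odot> dt b (ds F)) \<nu> $ l - (dt a (ds F') \<odot> dt b (ds F')) \<nu> $ l"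
    unfolding ambient[symmetric] right_diff_distrib sum_subtractf
      eqn[OF A(1), symmetric] eqn[OF A(2), symmetric] prim by simp
  also have "\<dots> = of_nat k * (v a * F {#b#} $ 1 + F {#a#} $ 1 * v b)"
  proof -
    have "(dt a (ds F) \<odot> dt b (ds F)) \<nu> $ l - (dt a (ds F') \<odot> dt b (ds F')) \<nu> $ l
        = (dt a (ds F) \<nu> $ l - dt a (ds F') \<nu> $ l) * dt b (ds F) {#} $ 0
          + dt a (ds F) {#} $ 0 * (dt b (ds F) \<nu> $ l - dt b (ds F') \<nu> $ l)"
      by (rule nth_ts_times_diff) (use agree ne in blast)+
    then show ?thesis by (simp add: diff unit algebra_simps)
  qed
  finally have "of_nat k * (\<Sum>f\<le>n. ambient_product n d F a b f * v f)
      = of_nat k * (v a * F {#b#} $ 1 + F {#a#} $ 1 * v b)"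
    by (subst (asm) sum.swap) (simp add: ambient_product_def sum_distrib_left sum_distrib_right mult_ac)
  then show ?thesis using k(1) by simp
qed

lemma equation_E_step:
  assumes "equation_E n d F" "equation_E n d F'" "fano_index n d \<noteq> 0"
    and "set_mset \<mu> \<subseteq> {..n}" "F \<mu> $ k = F' \<mu> $ k"
  shows "F (add_mset 1 \<mu>) $ k = F' (add_mset 1 \<mu>) $ k"
proof -
  have "euler_field n d F \<mu> $ k = euler_field n d F' \<mu> $ k"
    using assms(1,2,5) unfolding equation_E_def by (simp flip: fps_of_int)
  then have "of_int (fano_index n d) * of_nat (count \<mu> 1 + 1) * F (add_mset 1 \<mu>) $ k
      = of_int (fano_index n d) * of_nat (count \<mu> 1 + 1) * F' (add_mset 1 \<mu>) $ k"
    using assms(5) unfolding euler_field_nth[OF assms(4)] by simp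
  then show ?thesis using assms(3) by (simp del: of_nat_add of_nat_Suc)
qed

lemma gw_potential_origin:
  assumes "gw_potential n m Q gw F" "dimension_constraint n d m gw"
    and "gcd (int n - 2) (fano_index n d) > 1"
  shows "F {#} $ k = 0"
proof (rule ccontr)
  let ?g = "gcd (int n - 2) (fano_index n d)"
  assume "F {#} $ k \<noteq> 0"
  from gw_potential_dimension[OF assms(1,2) this]
  obtain \<beta> where "int k * (int n - 2) = int n - 3 + fano_index n d * int \<beta>" by auto
  then have "1 = (1 - int k) * (int n - 2) + fano_index n d * int \<beta>"
    by (simp add: algebra_simps)
  moreover have "?g dvd (1 - int k) * (int n - 2) + fano_index n d * int \<beta>"
    by (intro dvd_add dvd_mult dvd_mult2) auto
  ultimately have "?g dvd 1" by simp
  with assms(3) show False by simp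
qed

lemma gw_potential_hyperplane_zero:
  assumes "gw_potential n m Q gw F" "dimension_constraint n d m gw" "fano_index n d > 1"
  shows "F {#1#} $ 1 = 0"
proof (rule ccontr)
  assume "F {#1#} $ 1 \<noteq> 0"
  from gw_potential_dimension[OF assms(1,2) this]
  obtain \<beta> where "fano_index n d * int \<beta> = 1" by auto
  with assms(3) show False by (auto simp: zmult_eq_1_iff)
qed

theorem corollary1p8:
  fixes n m :: nat and d :: "nat list" and Q :: "nat \<Rightarrow> nat \<Rightarrow> complex"
    and gw gw' :: "nat \<Rightarrow> nat list \<Rightarrow> complex" and F F' :: ts_series
  assumes "n \<ge> 3" and "\<forall>i\<in>set d. i \<ge> 2" and "\<not> exceptional n d"
    and "fano_index n d > 0" and "gcd (int n - 2) (fano_index n d) > 1"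
    and "primitive_pairing n m Q"
    and "graded_symmetric n m gw" and "classical_limit n d m Q gw"
    and "dimension_constraint n d m gw"
    and "gw_potential n m Q gw F" and "equation_A n d m F" and "equation_E n d F"
    and "graded_symmetric n m gw'" and "classical_limit n d m Q gw'"
    and "dimension_constraint n d m gw'"
    and "gw_potential n m Q gw' F'" and "equation_A n d m F'" and "equation_E n d F'"
    and "restrict_s0 F = restrict_s0 F'"
  shows "F = F'"
proof -
  note pot = assms(10) assms(16) and dim = assms(9) assms(15) and cl = assms(8) assms(14)
    and A = assms(11) assms(17) and E = assms(12) assms(18)
  let ?K = "ambient_product n d F"
  have K': "ambient_product n d F' = ?K"
    using ambient_product_cong[OF assms(19)] by simp
  have "fano_index n d > 1"
    using zdvd_imp_le[OF gcd_dvd2 assms(4), of "int n - 2"] assms(5) by linarith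
  then have hyp: "F {#1#} $ 1 = 0" "F' {#1#} $ 1 = 0"
    using gw_potential_hyperplane_zero pot dim by blast+
  have kernel: "w f = 0"
    if "\<And>b. b < n \<Longrightarrow> (\<Sum>f\<le>n. ?K 1 b f * w f) = 0" "w 0 = 0" "f \<le> n" for w f
    using ambient_product_hyperplane_diag[OF pot(1) dim(1) cl(1) assms(4,2)]
      ambient_product_hyperplane_above[OF pot(1) dim(1) assms(4)] that
    by (rule hessenberg_kernel[where K = "?K 1"])
  have "F \<mu> $ k = F' \<mu> $ k" for \<mu> k
  proof (induction k arbitrary: \<mu> rule: less_induct)
    case (less k)
    note lower = less.IH
    show ?case
    proof (cases "k = 0 \<or> s_power_zero n m Q k")
      case True
      then show ?thesis
        using fun_cong[OF assms(19), of \<mu>] pot unfolding gw_potential_def restrict_s0_def by auto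
    next
      case False
      then have k: "k \<ge> 1" and s: "\<not> s_power_zero n m Q k" by auto
      have "m > 0"
      proof (rule ccontr)
        assume "\<not> m > 0"
        have "super_coeff n (s_power_word n m Q k) \<nu> = 0" for \<nu>
          using super_coeff_s_power_nonzero[of n m Q k \<nu>] k \<open>\<not> m > 0\<close> by fastforce
        with s show False by (simp add: s_power_zero_def)
      qed
      have k_le: "odd n \<longrightarrow> k \<le> m div 2"
        using s_power_zero_odd[of n m k Q] s by linarith
      then have odd: "odd n \<longrightarrow> 0 < m div 2" using k by auto
      have unit: "F {#0#} $ 1 \<noteq> 0"
        using gw_potential_unit_coeff_nonzero[OF pot(1) dim(1) cl(1) assms(4,6) \<open>m > 0\<close>] .
      show ?thesis
      proof (induction \<mu> rule: measure_induct_rule[of size])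
        case (less \<mu>)
        show ?case
        proof (cases "set_mset \<mu> \<subseteq> {..n}")
          case False
          then show ?thesis using pot unfolding gw_potential_def by simp
        next
          case ambient: True
          show ?thesis
          proof (cases \<mu>)
            case empty
            then show ?thesis using gw_potential_origin pot dim assms(5) by metis
          next
            case (add f \<nu>)
            have f: "f \<le> n" and \<nu>: "set_mset \<nu> \<subseteq> {..n}" using ambient add by auto
            show ?thesis
            proof (cases "(\<nu>, k) = ({#}, 1)")
              case True
              have "F {#f#} $ 1 - F' {#f#} $ 1 = 0"
              proof (rule kernel[of "\<lambda>f. F {#f#} $ 1 - F' {#f#} $ 1"])
                show "F {#0#} $ 1 - F' {#0#} $ 1 = 0"
                  using gw_potential_unit_coeff_unique[OF pot(1) dim(1) cl(1) pot(2) dim(2) cl(2) assms(4)]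
                  by simp
                show "(\<Sum>f\<le>n. ?K 1 b f * (F {#f#} $ 1 - F' {#f#} $ 1)) = 0" if "b < n" for b
                  using equation_A_at_origin[OF A(1) odd, of 1 b] equation_A_at_origin[OF A(2) odd, of 1 b]
                    hyp that assms(1) by (simp add: K' right_diff_distrib sum_subtractf)
              qed (rule f)
              then show ?thesis using True add by simp
            next
              case False
              define v where "v f = of_nat (count \<nu> f + 1) * (F (add_mset f \<nu>) $ k - F' (add_mset f \<nu>) $ k)" for f
              have "F \<mu>' $ k = F' \<mu>' $ k" if "size \<mu>' \<le> size \<nu>" for \<mu>'
                using less.IH[of \<mu>'] that add by simp
              note lin = equation_A_linearized[OF A k k_le False lower this _ _ v_def]
              have v1: "v 1 = 0"
                using equation_E_step[OF E _ \<nu>] less.IH[of \<nu>] add assms(4) by (simp add: v_def)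
              have proportional: "F {#0#} $ 1 * v g = v 0 * F {#g#} $ 1" if "g \<le> n" for g
              proof -
                have "F {#0#} $ 1 * v g - v 0 * F {#g#} $ 1 = 0"
                proof (rule kernel[of "\<lambda>f. F {#0#} $ 1 * v f - v 0 * F {#f#} $ 1"])
                  show "(\<Sum>f\<le>n. ?K 1 b f * (F {#0#} $ 1 * v f - v 0 * F {#f#} $ 1)) = 0" if "b < n" for b
                  proof -
                    have "(\<Sum>f\<le>n. ?K 1 b f * (F {#0#} $ 1 * v f - v 0 * F {#f#} $ 1))
                        = F {#0#} $ 1 * (\<Sum>f\<le>n. ?K 1 b f * v f) - v 0 * (\<Sum>f\<le>n. ?K 1 b f * F {#f#} $ 1)"
                      by (simp add: right_diff_distrib sum_subtractf sum_distrib_left mult_ac)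
                    also have "\<dots> = 0"
                      using lin[of 1 b] equation_A_at_origin[OF A(1) odd, of 1 b] hyp v1 that assms(1) by simp
                    finally show ?thesis .
                  qed
                qed (use that in simp_all)
                then show ?thesis by simp
              qed
              have "2 * (v 0 * (F {#0#} $ 1)\<^sup>2) = F {#0#} $ 1 * (\<Sum>f\<le>n. ?K 0 0 f * v f)"
                using lin[of 0 0] by (simp add: power2_eq_square algebra_simps)
              also have "\<dots> = (\<Sum>f\<le>n. ?K 0 0 f * (F {#0#} $ 1 * v f))"
                by (simp add: sum_distrib_left mult_ac)
              also have "\<dots> = (\<Sum>f\<le>n. ?K 0 0 f * (v 0 * F {#f#} $ 1))"
                by (intro sum.cong) (simp_all only: proportional atMost_iff)
              also have "\<dots> = v 0 * (\<Sum>f\<le>n. ?K 0 0 f * F {#f#} $ 1)"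
                by (simp add: sum_distrib_left mult_ac)
              also have "\<dots> = v 0 * (F {#0#} $ 1)\<^sup>2"
                using equation_A_at_origin[OF A(1) odd, of 0 0] by (simp add: power2_eq_square)
              finally have "v 0 = 0" using unit by simp
              then have "v f = 0" using proportional[OF f] unit by simp
              then show ?thesis using add by (simp add: v_def del: of_nat_add of_nat_Suc)
            qed
          qed
        qed
      qed
    qed
  qed
  then show ?thesis by (simp add: fun_eq_iff fps_eq_iff)
qed

end
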